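(* The CN calculus is sound for epistemic weight models: every formula of $\mathcal{L}_{CN}$ derivable in the CN calculus is true at every world of every epistemic weight model.
   Context: Fix a set $P$ of proposition letters and a finite set $Ag$ of agents. The language $\mathcal{L}_{CN}$ is given by $\phi::=\top\mid p\mid\neg\phi\mid(\phi\wedge\phi)\mid B_a(\phi,\phi)$ with $p\in P$, $a\in Ag$. $\bot,\vee,\to,\leftrightarrow$ are defined as usual; $K_a\phi$ abbreviates $\neg B_a(\neg\phi,\top)$ and $\check K_a\phi$ abbreviates $\neg K_a\neg\phi$. An epistemic weight model is $\mathfrak{M}=(W,R,L,V)$ where $W$ is a non-empty countable set, $R$ assigns to each $a\in Ag$ an equivalence relation $\sim_a$ on $W$ (with $[w]_a$ the class of $w$), $L$ assigns to each $a\in Ag$ a function $\mathbb{L}_a:W\to\mathbb{Q}^+$ (positive rationals) such that $\sum_{u\in[w]_a}\mathbb{L}_a(u)<\infty$ for all $a,w$, and $V:P\to\mathcal{P}(W)$. For $S\subseteq W$ write $\mathbb{L}_a(S)=\sum_{u\in S}\mathbb{L}_a(u)$. Truth: $\top$ always true, $p$ true at $w$ iff $w\in V(p)$, Boolean connectives as usual, and $\mathfrak{M},w\vDash B_a(\phi,\psi)$ iff $\mathbb{L}_a([w]_a\cap\llbracket\phi\wedge\psi\rrbracket_{\mathfrak{M}})>\mathbb{L}_a([w]_a\cap\llbracket\phi\wedge\neg\psi\rrbracket_{\mathfrak{M}})$, where $\llbracket\phi\rrbracket_{\mathfrak{M}}=\{v\mid\mathfrak{M},v\vDash\phi\}$.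 The CN calculus has axioms: (Taut) all propositional tautologies; (Dist-K) $K_a(\phi\to\psi)\to K_a\phi\to K_a\psi$; (T) $K_a\phi\to\phi$; (5B) $B_a(\phi,\psi)\to K_aB_a(\phi,\psi)$; (4B) $\neg B_a(\phi,\psi)\to K_a\neg B_a(\phi,\psi)$; (D) $B_a(\phi,\psi)\to\neg B_a(\phi,\neg\psi)$; (EC) $K_a(\phi\leftrightarrow\psi)\to B_a(\phi,\chi)\to B_a(\psi,\chi)$; (M) $K_a(\phi\to\psi)\to B_a(\chi,\phi)\to B_a(\chi,\psi)$; (C) $B_a(\phi,\psi)\to B_a(\phi,\phi\wedge\psi)$; (SC) $\neg B_a(\chi,\neg\phi)\wedge\check K_a(\chi\wedge\neg\phi\wedge\psi)\to B_a(\chi,\phi\vee\psi)$; rules Modus Ponens and (Nec-K): from $\phi$ infer $K_a\phi$. *)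

theory Defs
  imports "HOL-Analysis.Infinite_Sum" "HOL-Library.Countable_Set"
begin

section \<open>The language\<close>

text \<open>Proposition letters are the elements of the type \<open>'p\<close>, agents those of the type \<open>'ag\<close>.\<close>

datatype ('p, 'ag) fm =
    Top
  | Atom 'p
  | Neg "('p, 'ag) fm"
  | And "('p, 'ag) fm" "('p, 'ag) fm"
  | Bel 'ag "('p, 'ag) fm" "('p, 'ag) fm"

abbreviation Bot :: "('p, 'ag) fm" where
  "Bot \<equiv> Neg Top"

abbreviation Or :: "('p, 'ag) fm \<Rightarrow> ('p, 'ag) fm \<Rightarrow> ('p, 'ag) fm" where
  "Or \<phi> \<psi> \<equiv> Neg (And (Neg \<phi>) (Neg \<psi>))"

abbreviation Imp :: "('p, 'ag) fm \<Rightarrow> ('p, 'ag) fm \<Rightarrow> ('p, 'ag) fm" where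
  "Imp \<phi> \<psi> \<equiv> Or (Neg \<phi>) \<psi>"

abbreviation Iff :: "('p, 'ag) fm \<Rightarrow> ('p, 'ag) fm \<Rightarrow> ('p, 'ag) fm" where
  "Iff \<phi> \<psi> \<equiv> And (Imp \<phi> \<psi>) (Imp \<psi> \<phi>)"

abbreviation Kn :: "'ag \<Rightarrow> ('p, 'ag) fm \<Rightarrow> ('p, 'ag) fm" where
  "Kn a \<phi> \<equiv> Neg (Bel a (Neg \<phi>) Top)"

abbreviation Kn_dual :: "'ag \<Rightarrow> ('p, 'ag) fm \<Rightarrow> ('p, 'ag) fm" where
  "Kn_dual a \<phi> \<equiv> Neg (Kn a (Neg \<phi>))"


section \<open>Epistemic weight models\<close>

record ('p, 'ag, 'w) wmodel =
  worlds :: "'w set"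
  acc :: "'ag \<Rightarrow> ('w \<times> 'w) set"
  weight :: "'ag \<Rightarrow> 'w \<Rightarrow> rat"
  val :: "'p \<Rightarrow> 'w set"

definition cell :: "('p, 'ag, 'w) wmodel \<Rightarrow> 'ag \<Rightarrow> 'w \<Rightarrow> 'w set" where
  "cell M a w = acc M a `` {w}"

definition set_weight :: "('p, 'ag, 'w) wmodel \<Rightarrow> 'ag \<Rightarrow> 'w set \<Rightarrow> real" where
  "set_weight M a S = (\<Sum>\<^sub>\<infinity>u\<in>S. real_of_rat (weight M a u))"

text \<open>
  The sum over a cell is taken in the reals: weights are rational, but a convergent series
  of rationals need not have a rational sum.  The values of \<^const>\<open>weight\<close> outside
  \<^const>\<open>worlds\<close> are irrelevant.
\<close>

definition epistemic_weight_model :: "('p, 'ag, 'w) wmodel \<Rightarrow> bool" where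
  "epistemic_weight_model M \<longleftrightarrow>
     worlds M \<noteq> {} \<and> countable (worlds M) \<and>
     (\<forall>a. equiv (worlds M) (acc M a)) \<and>
     (\<forall>a. \<forall>w\<in>worlds M. weight M a w > 0) \<and>
     (\<forall>a. \<forall>w\<in>worlds M. (\<lambda>u. real_of_rat (weight M a u)) summable_on cell M a w) \<and>
     (\<forall>p. val M p \<subseteq> worlds M)"

text \<open>
  For primitive recursion, the truth sets of \<open>\<phi> \<and> \<psi>\<close> and \<open>\<phi> \<and> \<not> \<psi>\<close> are written out in the
  clause for \<^const>\<open>Bel\<close>; lemma \<open>sat_Bel\<close> below states the clause in terms of truth sets.
\<close>

primrec sat :: "('p, 'ag, 'w) wmodel \<Rightarrow> 'w \<Rightarrow> ('p, 'ag) fm \<Rightarrow> bool" where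
  "sat M w Top \<longleftrightarrow> True"
| "sat M w (Atom p) \<longleftrightarrow> w \<in> val M p"
| "sat M w (Neg \<phi>) \<longleftrightarrow> \<not> sat M w \<phi>"
| "sat M w (And \<phi> \<psi>) \<longleftrightarrow> sat M w \<phi> \<and> sat M w \<psi>"
| "sat M w (Bel a \<phi> \<psi>) \<longleftrightarrow>
     set_weight M a (cell M a w \<inter> {v \<in> worlds M. sat M v \<phi> \<and> sat M v \<psi>})
     > set_weight M a (cell M a w \<inter> {v \<in> worlds M. sat M v \<phi> \<and> \<not> sat M v \<psi>})"

definition truth_set :: "('p, 'ag, 'w) wmodel \<Rightarrow> ('p, 'ag) fm \<Rightarrow> 'w set" where
  "truth_set M \<phi> = {v \<in> worlds M. sat M v \<phi>}"

lemma sat_Bel: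
  "sat M w (Bel a \<phi> \<psi>) \<longleftrightarrow>
     set_weight M a (cell M a w \<inter> truth_set M (And \<phi> \<psi>))
     > set_weight M a (cell M a w \<inter> truth_set M (And \<phi> (Neg \<psi>)))"
  by (simp add: truth_set_def)


section \<open>The calculus\<close>

text \<open>
  A formula is a propositional tautology (that is, a substitution instance of a tautology of
  propositional logic) iff it is true under every Boolean valuation that treats proposition
  letters and formulas of the form \<open>B\<^sub>a(\<phi>, \<psi>)\<close> as propositional atoms.
\<close>

primrec bool_eval :: "(('p, 'ag) fm \<Rightarrow> bool) \<Rightarrow> ('p, 'ag) fm \<Rightarrow> bool" where
  "bool_eval h Top \<longleftrightarrow> True"
| "bool_eval h (Atom p) \<longleftrightarrow> h (Atom p)"
| "bool_eval h (Neg \<phi>) \<longleftrightarrow> \<not> bool_eval h \<phi>"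
| "bool_eval h (And \<phi> \<psi>) \<longleftrightarrow> bool_eval h \<phi> \<and> bool_eval h \<psi>"
| "bool_eval h (Bel a \<phi> \<psi>) \<longleftrightarrow> h (Bel a \<phi> \<psi>)"

definition tautology :: "('p, 'ag) fm \<Rightarrow> bool" where
  "tautology \<phi> \<longleftrightarrow> (\<forall>h. bool_eval h \<phi>)"

inductive CN_derivable :: "('p, 'ag) fm \<Rightarrow> bool" where
  Taut: "tautology \<phi> \<Longrightarrow> CN_derivable \<phi>"
| Dist_K: "CN_derivable (Imp (Kn a (Imp \<phi> \<psi>)) (Imp (Kn a \<phi>) (Kn a \<psi>)))"
| T: "CN_derivable (Imp (Kn a \<phi>) \<phi>)"
| Five_B: "CN_derivable (Imp (Bel a \<phi> \<psi>) (Kn a (Bel a \<phi> \<psi>)))"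
| Four_B: "CN_derivable (Imp (Neg (Bel a \<phi> \<psi>)) (Kn a (Neg (Bel a \<phi> \<psi>))))"
| D: "CN_derivable (Imp (Bel a \<phi> \<psi>) (Neg (Bel a \<phi> (Neg \<psi>))))"
| EC: "CN_derivable (Imp (Kn a (Iff \<phi> \<psi>)) (Imp (Bel a \<phi> \<chi>) (Bel a \<psi> \<chi>)))"
| M: "CN_derivable (Imp (Kn a (Imp \<phi> \<psi>)) (Imp (Bel a \<chi> \<phi>) (Bel a \<chi> \<psi>)))"
| C: "CN_derivable (Imp (Bel a \<phi> \<psi>) (Bel a \<phi> (And \<phi> \<psi>)))"
| SC: "CN_derivable
         (Imp (And (Neg (Bel a \<chi> (Neg \<phi>))) (Kn_dual a (And (And \<chi> (Neg \<phi>)) \<psi>)))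
              (Bel a \<chi> (Or \<phi> \<psi>)))"
| MP: "CN_derivable (Imp \<phi> \<psi>) \<Longrightarrow> CN_derivable \<phi> \<Longrightarrow> CN_derivable \<psi>"
| Nec_K: "CN_derivable \<phi> \<Longrightarrow> CN_derivable (Kn a \<phi>)"

end

theory Submission
  imports Defs
begin

text \<open>
  The weight of a subset of a cell is strictly monotone in the subset. In particular it is positive
  exactly on nonempty subsets, so \<open>K\<^sub>a\<close> quantifies over the cell. The axioms about \<open>B\<^sub>a\<close> then
  compare weights of subsets of one fixed cell.
\<close>

lemma cell_subset_worlds:
  assumes "epistemic_weight_model M"
  shows "cell M a w \<subseteq> worlds M"
  using assms unfolding epistemic_weight_model_def equiv_def refl_on_def cell_def by blast

lemma self_in_cell:
  assumes "epistemic_weight_model M" "w \<in> worlds M"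
  shows "w \<in> cell M a w"
  using assms unfolding epistemic_weight_model_def cell_def
  by (meson equiv_class_self)

lemma cell_eq:
  assumes "epistemic_weight_model M" "v \<in> cell M a w"
  shows "cell M a v = cell M a w"
  using assms unfolding epistemic_weight_model_def cell_def
  by (metis Image_singleton_iff equiv_class_eq)

lemma set_weight_strict_mono:
  assumes "epistemic_weight_model M" "w \<in> worlds M" "A \<subset> B" "B \<subseteq> cell M a w"
  shows "set_weight M a A < set_weight M a B"
proof -
  let ?f = "\<lambda>u. real_of_rat (weight M a u)"
  have pos: "?f u > 0" if "u \<in> B" for u
    using that assms cell_subset_worlds[OF assms(1), of a w]
    by (auto simp: epistemic_weight_model_def)
  \<comment> \<open>\<open>infsum\<close> defaults to 0 on a family that is not summable, so
    summability is carried from the cell down to every subset of \<open>B\<close> before any sums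
    are compared.\<close>
  have "?f summable_on cell M a w"
    using assms by (simp add: epistemic_weight_model_def)
  then have summ: "?f summable_on S" if "S \<subseteq> B" for S
    using that assms(4) by (meson summable_on_subset_banach subset_trans)
  obtain v where v: "v \<in> B" "v \<notin> A" using assms(3) by blast
  have "infsum ?f A < ?f v + infsum ?f A" using pos v by simp
  also have "\<dots> = infsum ?f (insert v A)"
    using v assms(3) summ[of A] by (subst infsum_insert) auto
  also have "\<dots> \<le> infsum ?f B"
    using v assms(3) less_imp_le[OF pos] by (intro infsum_mono2 summ) blast+
  finally show ?thesis by (simp add: set_weight_def)
qed

lemma set_weight_mono:
  assumes "epistemic_weight_model M" "w \<in> worlds M" "A \<subseteq> B" "B \<subseteq> cell M a w"
  shows "set_weight M a A \<le> set_weight M a B"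
  using set_weight_strict_mono[OF assms(1,2), of A B a] assms(3,4)
  by (cases "A = B") (simp_all add: psubset_eq less_imp_le)

lemma sat_Bel_cell:
  assumes "epistemic_weight_model M"
  shows "sat M w (Bel a \<phi> \<psi>) \<longleftrightarrow>
    set_weight M a {v \<in> cell M a w. sat M v \<phi> \<and> \<not> sat M v \<psi>}
    < set_weight M a {v \<in> cell M a w. sat M v \<phi> \<and> sat M v \<psi>}"
proof -
  have "cell M a w \<inter> {v \<in> worlds M. Q v} = {v \<in> cell M a w. Q v}" for Q
    using cell_subset_worlds[OF assms, of a w] by blast
  then show ?thesis by simp
qed

text \<open>The truth clause of \<open>Bel\<close> depends on the world only through its cell. This
  yields both introspection axioms.\<close>

lemma sat_Bel_cong:
  assumes "epistemic_weight_model M" "v \<in> cell M a w"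
  shows "sat M v (Bel a \<phi> \<psi>) \<longleftrightarrow> sat M w (Bel a \<phi> \<psi>)"
  using cell_eq[OF assms] by (simp only: sat.simps)

lemma sat_Kn:
  assumes "epistemic_weight_model M" "w \<in> worlds M"
  shows "sat M w (Kn a \<phi>) \<longleftrightarrow> (\<forall>v\<in>cell M a w. sat M v \<phi>)"
proof -
  let ?S = "{v \<in> cell M a w. \<not> sat M v \<phi>}"
  \<comment> \<open>The empty set arises from the worlds that falsify \<open>Top\<close>.\<close>
  have "sat M w (Kn a \<phi>) \<longleftrightarrow> \<not> set_weight M a {} < set_weight M a ?S"
    by (simp add: sat_Bel_cell[OF assms(1)] del: sat.simps(5))
  also have "\<dots> \<longleftrightarrow> ?S = {}"
    using set_weight_strict_mono[OF assms, of "{}" ?S a]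
    by (metis (no_types, lifting) empty_subsetI less_irrefl mem_Collect_eq psubsetI subsetI)
  finally show ?thesis by blast
qed

lemma sat_Imp: "sat M w (Imp \<phi> \<psi>) \<longleftrightarrow> (sat M w \<phi> \<longrightarrow> sat M w \<psi>)"
  by simp

text \<open>Truth at a fixed world is itself one of the Boolean valuations over which
  \<open>tautology\<close> quantifies.\<close>

lemma bool_eval_sat: "bool_eval (sat M w) \<phi> \<longleftrightarrow> sat M w \<phi>"
  by (induction \<phi>) simp_all

text \<open>Passing from \<phi> to \<psi> can only enlarge the heavier side and shrink the lighter
  one. The implication is required only where \<chi> holds, so that the lemma covers axiom
  \<open>C\<close> as well as \<open>M\<close>.\<close>

lemma sat_Bel_mono:
  assumes "epistemic_weight_model M" "w \<in> worlds M"
    and imp: "\<forall>v\<in>cell M a w. sat M v \<chi> \<longrightarrow> sat M v \<phi> \<longrightarrow> sat M v \<psi>"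
    and "sat M w (Bel a \<chi> \<phi>)"
  shows "sat M w (Bel a \<chi> \<psi>)"
proof -
  have "set_weight M a {v \<in> cell M a w. sat M v \<chi> \<and> \<not> sat M v \<psi>}
      \<le> set_weight M a {v \<in> cell M a w. sat M v \<chi> \<and> \<not> sat M v \<phi>}"
    using imp by (intro set_weight_mono[OF assms(1,2)]) auto
  moreover have "set_weight M a {v \<in> cell M a w. sat M v \<chi> \<and> sat M v \<phi>}
      \<le> set_weight M a {v \<in> cell M a w. sat M v \<chi> \<and> sat M v \<psi>}"
    using imp by (intro set_weight_mono[OF assms(1,2)]) auto
  ultimately show ?thesis
    using assms(4) unfolding sat_Bel_cell[OF assms(1)] by linarith
qed

lemma sat_Bel_antecedent_cong:
  assumes "epistemic_weight_model M"
    and "\<forall>v\<in>cell M a w. sat M v \<phi> \<longleftrightarrow> sat M v \<psi>"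
  shows "sat M w (Bel a \<phi> \<chi>) \<longleftrightarrow> sat M w (Bel a \<psi> \<chi>)"
proof -
  have "{v \<in> cell M a w. sat M v \<phi> \<and> Q v} = {v \<in> cell M a w. sat M v \<psi> \<and> Q v}" for Q
    using assms(2) by blast
  then show ?thesis by (simp only: sat_Bel_cell[OF assms(1)])
qed

text \<open>Failure of belief in \<open>Neg \<phi>\<close> still allows a tie between the part of
  \<chi> where \<phi> holds and the part where it fails. The world \<open>v\<close> breaks the tie:
  it leaves the second part once \<phi> is weakened to \<open>Or \<phi> \<psi>\<close>.\<close>

lemma sat_Bel_Or:
  assumes "epistemic_weight_model M" "w \<in> worlds M"
    and nB: "\<not> sat M w (Bel a \<chi> (Neg \<phi>))"
    and v: "v \<in> cell M a w" "sat M v \<chi>" "\<not> sat M v \<phi>" "sat M v \<psi>"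
  shows "sat M w (Bel a \<chi> (Or \<phi> \<psi>))"
proof -
  let ?S = "\<lambda>Q. {v \<in> cell M a w. sat M v \<chi> \<and> Q v}"
  have "set_weight M a (?S (\<lambda>v. \<not> sat M v (Or \<phi> \<psi>)))
      < set_weight M a (?S (\<lambda>v. \<not> sat M v \<phi>))"
    using v by (intro set_weight_strict_mono[OF assms(1,2)]) auto
  also have "\<dots> \<le> set_weight M a (?S (\<lambda>v. sat M v \<phi>))"
    using nB unfolding sat_Bel_cell[OF assms(1)] by simp
  also have "\<dots> \<le> set_weight M a (?S (\<lambda>v. sat M v (Or \<phi> \<psi>)))"
    by (intro set_weight_mono[OF assms(1,2)]) auto
  finally show ?thesis unfolding sat_Bel_cell[OF assms(1)] .
qed

theorem theorem2:
  fixes \<phi> :: "('p, 'ag::finite) fm"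
    and M :: "('p, 'ag, 'w) wmodel"
    and w :: 'w
  assumes "CN_derivable \<phi>"
    and "epistemic_weight_model M"
    and "w \<in> worlds M"
  shows "sat M w \<phi>"
  using assms(1,3)
\<comment> \<open>The world varies because necessitation needs the induction hypothesis at every
  world of the cell.\<close>
proof (induction arbitrary: w rule: CN_derivable.induct)
  case (Taut \<phi>)
  then show ?case by (metis bool_eval_sat tautology_def)
next
  case (Dist_K a \<phi> \<psi>)
  then show ?case unfolding sat_Imp sat_Kn[OF assms(2) Dist_K] by blast
next
  case (T a \<phi>)
  then show ?case
    unfolding sat_Imp sat_Kn[OF assms(2) T] using self_in_cell[OF assms(2)] by blast
next
  case (Five_B a \<phi> \<psi>)
  then show ?case
    unfolding sat_Imp sat_Kn[OF assms(2) Five_B]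
    using sat_Bel_cong[OF assms(2), of _ a w \<phi> \<psi>] by blast
next
  case (Four_B a \<phi> \<psi>)
  then show ?case
    unfolding sat_Imp sat_Kn[OF assms(2) Four_B] unfolding sat.simps(3)
    using sat_Bel_cong[OF assms(2), of _ a w \<phi> \<psi>] by blast
next
  case (D a \<phi> \<psi>)
  \<comment> \<open>Negating \<psi> swaps the two sides of the comparison, and \<open><\<close> is
    asymmetric.\<close>
  then show ?case by simp
next
  case (EC a \<phi> \<psi> \<chi>)
  have "sat M w (Bel a \<psi> \<chi>)" if "sat M w (Kn a (Iff \<phi> \<psi>))" "sat M w (Bel a \<phi> \<chi>)"
  proof -
    have "\<forall>v\<in>cell M a w. sat M v \<phi> \<longleftrightarrow> sat M v \<psi>"
      using that(1) unfolding sat_Kn[OF assms(2) EC] by auto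
    then show ?thesis using sat_Bel_antecedent_cong[OF assms(2), of a w \<phi> \<psi> \<chi>] that(2) by blast
  qed
  then show ?case unfolding sat_Imp by blast
next
  case (M a \<phi> \<psi> \<chi>)
  then show ?case
    unfolding sat_Imp sat_Kn[OF assms(2) M] using sat_Bel_mono[OF assms(2) M, of a \<chi> \<phi> \<psi>] by blast
next
  case (C a \<phi> \<psi>)
  then show ?case
    \<comment> \<open>Where the condition \<phi> holds, \<psi> already implies
      \<open>And \<phi> \<psi>\<close>.\<close>
    unfolding sat_Imp using sat_Bel_mono[OF assms(2) C, of a \<phi> \<psi> "And \<phi> \<psi>"] by auto
next
  case (SC a \<chi> \<phi> \<psi>)
  have "sat M w (Bel a \<chi> (Or \<phi> \<psi>))"
    if nB: "\<not> sat M w (Bel a \<chi> (Neg \<phi>))"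
      and K: "\<not> sat M w (Kn a (Neg (And (And \<chi> (Neg \<phi>)) \<psi>)))"
  proof -
    obtain v where "v \<in> cell M a w" "sat M v \<chi>" "\<not> sat M v \<phi>" "sat M v \<psi>"
      using K unfolding sat_Kn[OF assms(2) SC] by auto
    then show ?thesis using sat_Bel_Or[OF assms(2) SC nB] by blast
  qed
  then show ?case unfolding sat_Imp sat.simps(3,4) by blast
next
  case (MP \<phi> \<psi>)
  then show ?case unfolding sat_Imp by blast
next
  case (Nec_K \<phi> a)
  then show ?case
    unfolding sat_Kn[OF assms(2) Nec_K.prems] using cell_subset_worlds[OF assms(2)] by blast
qed

end
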